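(* Let $n\ge2$, $\alpha\in\left(\frac{-1}{n-1},1\right)$ and $A\in\mathbb{R}^{n\times n}$. Then there exists $S\in EM^n_\alpha$ such that $S^{-1}AS=T$ is a (real) block upper triangular matrix with $1\times1$ and $2\times2$ blocks on its diagonal. The eigenvalues of $A$ are the eigenvalues of the diagonal blocks of $T$; the $1\times1$ blocks correspond to real eigenvalues, and the $2\times2$ blocks to pairs of complex conjugate eigenvalues.
   Context: $EM^n_\alpha$ denotes the set of nonsingular real $n\times n$ matrices $S=[s_1,\dots,s_n]$ whose columns satisfy $s_i^Ts_i=1$ and $s_i^Ts_j=\alpha$ for $i\ne j$. *)

theory Defs
  imports
    "Jordan_Normal_Form.Spectral_Radius"
    "Jordan_Normal_Form.DL_Submatrix"
begin

definition EM :: "nat \<Rightarrow> real \<Rightarrow> real mat set" where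
  "EM n \<alpha> = {S \<in> carrier_mat n n. invertible_mat S \<and>
     (\<forall>i<n. col S i \<bullet> col S i = 1) \<and>
     (\<forall>i<n. \<forall>j<n. i \<noteq> j \<longrightarrow> col S i \<bullet> col S j = \<alpha>)}"

(* A block partition is given by the list ns of the successive block sizes. *)

definition block_range :: "nat list \<Rightarrow> nat \<Rightarrow> nat set" where
  "block_range ns k = {sum_list (take k ns) ..< sum_list (take (Suc k) ns)}"

definition block :: "nat list \<Rightarrow> 'a mat \<Rightarrow> nat \<Rightarrow> nat \<Rightarrow> 'a mat" where
  "block ns T k l = submatrix T (block_range ns k) (block_range ns l)"

definition block_upper_triangular :: "nat list \<Rightarrow> 'a::zero mat \<Rightarrow> bool" where
  "block_upper_triangular ns T \<longleftrightarrow>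
     T \<in> carrier_mat (sum_list ns) (sum_list ns) \<and>
     (\<forall>k<length ns. \<forall>l<k. block ns T k l = 0\<^sub>m (ns ! k) (ns ! l))"

(* Eigenvalues of a real matrix are taken over the complex numbers. *)

abbreviation complex_spectrum :: "real mat \<Rightarrow> complex set" where
  "complex_spectrum B \<equiv> spectrum (map_mat complex_of_real B)"

definition alg_multiplicity :: "real mat \<Rightarrow> complex \<Rightarrow> nat" where
  "alg_multiplicity B z = Polynomial.order z (char_poly (map_mat complex_of_real B))"

end

theory Submission
  imports Defs
begin

text \<open>
  The matrix \<open>A\<close> is first brought to quasi-triangular form \<open>T\<^sub>0 = P\<^sup>-\<^sup>1AP\<close> by deflating real invariant
  subspaces, spanned by a real eigenvector or by the real and imaginary part of a non-real one.
  Conjugating \<open>T\<^sub>0\<close> by an upper triangular matrix keeps its block shape, so the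
  columns of \<open>P\<close> may be recombined triangularly. Cholesky factorisations \<open>P\<^sup>TP = R\<^sup>TR\<close> and
  \<open>M = L\<^sup>TL\<close> of the Gram matrix \<open>P\<^sup>TP\<close> and of the prescribed one \<open>M = (1 - \<alpha>)I + \<alpha>J\<close>, which is
  positive definite exactly for the given range of \<open>\<alpha>\<close>, yield \<open>S = PR\<^sup>-\<^sup>1L\<close> with \<open>S\<^sup>TS = M\<close>.
\<close>

section \<open>Deflation\<close>

lemma obtain_inverse_mat:
  fixes P :: "'a::field mat"
  assumes "P \<in> carrier_mat n n" "det P \<noteq> 0"
  obtains Q where "Q \<in> carrier_mat n n" "P * Q = 1\<^sub>m n" "Q * P = 1\<^sub>m n"
  using det_non_zero_imp_unit[OF assms, unfolded Units_def, of "()"]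
  by (auto simp: ring_mat_def)

lemma det_nonzero_if_inverse:
  fixes P :: "'a::field mat"
  assumes "P \<in> carrier_mat n n" "Q \<in> carrier_mat n n" "P * Q = 1\<^sub>m n"
  shows "det P \<noteq> 0" "det Q \<noteq> 0"
  using det_mult[OF assms(1,2)] assms(3) by auto

lemma mat_mult_unit_vec:
  fixes P :: "'a::semiring_1 mat"
  assumes "P \<in> carrier_mat nr nc" "j < nc"
  shows "P *\<^sub>v unit_vec nc j = col P j"
  using assms by (intro eq_vecI) auto

text \<open>Gram-Schmidt orthogonalisation of a basis that begins with \<open>v\<close> keeps its
  first vector. The orthogonal columns so obtained form a matrix with an explicit left inverse,
  hence with nonzero determinant.\<close>

lemma ex_nonsingular_col:
  fixes v :: "real vec"
  assumes v: "v \<in> carrier_vec n" and v0: "v \<noteq> 0\<^sub>v n"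
  shows "\<exists>P \<in> carrier_mat n n. det P \<noteq> 0 \<and> col P 0 = v"
proof -
  have n: "n \<noteq> 0"
    using v v0 by (metis carrier_vecD eq_vecI index_zero_vec(2) less_nat_zero_code)
  interpret cof_vec_space n "TYPE(real)" .
  define b where "b = basis_completion v"
  define ws where "ws = gram_schmidt n b"
  define W where "W = mat_of_cols n ws"
  note bc = basis_completion[OF v v0, folded b_def]
  have len: "length b = n" using bc by auto
  with bc(7) n obtain vs where bv: "b = v # vs" by (cases b, auto)
  from gram_schmidt_result[OF bc(2,4,5) refl, folded ws_def]
  have ws: "set ws \<subseteq> carrier_vec n" "corthogonal ws" "length ws = n"
    by (auto simp: len)
  from gram_schmidt_hd[OF v, of vs, folded bv] have hdws: "hd ws = v" unfolding ws_def .
  have W: "W \<in> carrier_mat n n"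
    using ws mat_of_cols_carrier(1)[of n ws] unfolding W_def by auto
  have orth: "corthogonal_mat W" using orthogonal_mat_of_cols ws unfolding W_def .
  have W': "corthogonal_inv W \<in> carrier_mat n n"
    unfolding corthogonal_inv_def using W by (auto simp: mat_of_rows_def)
  have "corthogonal_inv W * W = 1\<^sub>m n"
    using corthogonal_inv_result[OF orth] W' unfolding inverts_mat_def by auto
  then have "det W \<noteq> 0" using det_nonzero_if_inverse W W' by blast
  moreover have "col W 0 = v"
    using ws n hdws unfolding W_def by (subst col_mat_of_cols) (auto simp: hd_conv_nth)
  ultimately show ?thesis using W by blast
qed

text \<open>Take a nonsingular \<open>P\<close> with first column \<open>u\<close> and pass to the
  coordinates \<open>w\<close> = P^-1 \<open>v\<close>. Independence means that \<open>w\<close> is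
  nonzero below its first entry; this tail \<open>w'\<close> is completed to a nonsingular
  \<open>R\<close>. Bordering \<open>R\<close> yields \<open>M\<close> with first columns e_1 and
  \<open>w\<close>, so that \<open>P * M\<close> starts with \<open>u\<close> and
  \<open>v\<close>.\<close>

lemma ex_nonsingular_two_cols:
  fixes u v :: "real vec"
  assumes u: "u \<in> carrier_vec n" and u0: "u \<noteq> 0\<^sub>v n"
    and v: "v \<in> carrier_vec n" and indep: "\<And>c. v \<noteq> c \<cdot>\<^sub>v u"
  shows "\<exists>P \<in> carrier_mat n n. 2 \<le> n \<and> det P \<noteq> 0 \<and> col P 0 = u \<and> col P 1 = v"
proof -
  have n: "n \<noteq> 0"
    using u u0 by (metis carrier_vecD eq_vecI index_zero_vec(2) less_nat_zero_code)
  then obtain m where nm: "n = 1 + m" by (metis add.commute Suc_eq_plus1 not0_implies_Suc)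
  obtain P where P: "P \<in> carrier_mat n n" "det P \<noteq> 0" "col P 0 = u"
    using ex_nonsingular_col[OF u u0] by blast
  obtain Q where Q: "Q \<in> carrier_mat n n" "P * Q = 1\<^sub>m n" "Q * P = 1\<^sub>m n"
    using obtain_inverse_mat[OF P(1,2)] .
  define w where "w = Q *\<^sub>v v"
  have w: "w \<in> carrier_vec n" using Q v unfolding w_def by auto
  have Pw: "P *\<^sub>v w = v" unfolding w_def using P Q v
    by (metis assoc_mult_mat_vec one_mult_mat_vec)
  define w' where "w' = vec m (\<lambda>i. w $ Suc i)"
  have w': "w' \<in> carrier_vec m" unfolding w'_def by auto
  have "w' \<noteq> 0\<^sub>v m"
  proof
    assume "w' = 0\<^sub>v m"
    then have z: "\<And>i. i < m \<Longrightarrow> w $ Suc i = 0" unfolding w'_def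
      by (metis index_vec index_zero_vec(1))
    have "w = w $ 0 \<cdot>\<^sub>v unit_vec n 0"
    proof (rule eq_vecI)
      fix i assume "i < dim_vec (w $ 0 \<cdot>\<^sub>v unit_vec n 0)"
      then show "w $ i = (w $ 0 \<cdot>\<^sub>v unit_vec n 0) $ i"
        using z nm by (cases i) auto
    qed (use w in auto)
    then have "v = P *\<^sub>v (w $ 0 \<cdot>\<^sub>v unit_vec n 0)" using Pw by simp
    also have "\<dots> = w $ 0 \<cdot>\<^sub>v u"
      using P n by (simp add: mult_mat_vec mat_mult_unit_vec)
    finally show False using indep by blast
  qed
  then obtain R where R: "R \<in> carrier_mat m m" "det R \<noteq> 0" "col R 0 = w'"
    using ex_nonsingular_col[OF w'] by blast
  have m: "m \<noteq> 0"
    using w' \<open>w' \<noteq> 0\<^sub>v m\<close> by (metis carrier_vecD eq_vecI index_zero_vec(2) less_nat_zero_code)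
  \<comment> \<open>The row \<open>r\<close> puts the top coordinate of \<open>w\<close> above the
    tail \<open>w'\<close>, so that column 1 of \<open>M\<close> is all of \<open>w\<close>.\<close>
  define r where "r = mat 1 m (\<lambda>(i,j). w $ 0)"
  define M where "M = four_block_mat (1\<^sub>m 1) r (0\<^sub>m m 1) R"
  have r: "r \<in> carrier_mat 1 m" unfolding r_def by auto
  have M: "M \<in> carrier_mat n n" using R nm unfolding M_def by auto
  have "det M = det (1\<^sub>m 1 :: real mat) * det R"
    unfolding M_def by (rule det_four_block_mat_lower_left_zero[OF _ r _ R(1)]) auto
  then have "det M \<noteq> 0" using R by simp
  then have "det (P * M) \<noteq> 0" using P M by (simp add: det_mult)
  moreover have "col M 0 = unit_vec n 0"
    unfolding M_def using R nm by (intro eq_vecI) auto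
  then have "col (P * M) 0 = u"
    using P n col_mult2[OF P(1) M, of 0] mat_mult_unit_vec[OF P(1), of 0] by simp
  moreover have "col M 1 = w"
  proof (rule eq_vecI)
    fix i assume "i < dim_vec w"
    then have i: "i < n" using w by auto
    then have "w $ i = (if i = 0 then w $ 0 else col R 0 $ (i - 1))"
      using nm unfolding R(3) w'_def by auto
    then show "col M 1 $ i = w $ i"
      using i m nm R r unfolding M_def by (auto simp: r_def)
  qed (use M w in auto)
  then have "col (P * M) 1 = v" using m nm Pw col_mult2[OF P(1) M, of 1] by simp
  ultimately show ?thesis using P M m nm by (intro bexI[of _ "P * M"]) auto
qed

text \<open>Assumption \<open>inv\<close> says that the first \<open>m\<close> columns of
  \<open>P\<close> span an \<open>A\<close>-invariant subspace on which \<open>A\<close> acts by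
  \<open>B\<close>. In the basis of columns of \<open>P\<close> the first \<open>m\<close> columns
  of \<open>A\<close> are therefore those of \<open>B\<close> padded with zeros.\<close>

lemma deflation:
  fixes A :: "'a::field mat"
  assumes A: "A \<in> carrier_mat (m + k) (m + k)" and P: "P \<in> carrier_mat (m + k) (m + k)"
    and det: "det P \<noteq> 0" and B: "B \<in> carrier_mat m m"
    and inv: "\<And>j. j < m \<Longrightarrow>
      A *\<^sub>v col P j = P *\<^sub>v vec (m + k) (\<lambda>i. if i < m then B $$ (i,j) else 0)"
  shows "\<exists>C \<in> carrier_mat m k. \<exists>D \<in> carrier_mat k k. \<exists>Q.
    similar_mat_wit A (four_block_mat B C (0\<^sub>m k m) D) P Q"
proof -
  let ?n = "m + k"
  obtain Q where Q: "Q \<in> carrier_mat ?n ?n" "P * Q = 1\<^sub>m ?n" "Q * P = 1\<^sub>m ?n"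
    using obtain_inverse_mat[OF P det] .
  define T where "T = Q * A * P"
  have T: "T \<in> carrier_mat ?n ?n" using A P Q unfolding T_def by auto
  have "P * T * Q = (P * Q) * A * (P * Q)"
    using A P Q(1) unfolding T_def by (simp add: assoc_mult_mat[of _ ?n ?n _ ?n _ ?n])
  then have wit: "similar_mat_wit A T P Q"
    using A P Q T by (intro similar_mat_witI[of _ _ ?n]) auto
  have colT: "col T j = vec ?n (\<lambda>i. if i < m then B $$ (i,j) else 0)" if "j < m" for j
  proof -
    let ?v = "vec ?n (\<lambda>i. if i < m then B $$ (i,j) else 0)"
    have "T = Q * (A * P)" using A P Q(1) unfolding T_def by simp
    then have "col T j = Q *\<^sub>v (A *\<^sub>v col P j)"
      using that col_mult2[OF Q(1) mult_carrier_mat[OF A P], of j] col_mult2[OF A P, of j] by simp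
    also have "\<dots> = Q *\<^sub>v (P *\<^sub>v ?v)" using inv that by simp
    also have "\<dots> = ?v"
      using Q P by (subst assoc_mult_mat_vec[symmetric, of _ ?n ?n _ ?n]) auto
    finally show ?thesis .
  qed
  have colT': "T $$ (i,j) = (if i < m then B $$ (i,j) else 0)" if "i < ?n" "j < m" for i j
    using arg_cong[OF colT[OF that(2)], of "\<lambda>v. v $ i"] that T by auto
  define C where "C = mat m k (\<lambda>(i,j). T $$ (i, m + j))"
  define D where "D = mat k k (\<lambda>(i,j). T $$ (m + i, m + j))"
  have "T = four_block_mat B C (0\<^sub>m k m) D"
    using T B by (intro eq_matI) (auto simp: C_def D_def colT')
  moreover have "C \<in> carrier_mat m k" "D \<in> carrier_mat k k" unfolding C_def D_def by auto
  ultimately show ?thesis using wit by blast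
qed

section \<open>Real Schur form\<close>

lemma char_poly_complex_of_real:
  assumes "B \<in> carrier_mat n n"
  shows "char_poly (map_mat complex_of_real B) = map_poly complex_of_real (char_poly B)"
  using of_real_hom.char_poly_hom[OF assms] .

lemma complex_spectrum_eq_roots:
  assumes "B \<in> carrier_mat n n"
  shows "complex_spectrum B = {z. poly (map_poly complex_of_real (char_poly B)) z = 0}"
  using assms by (simp add: spectrum_root_char_poly[of _ n] char_poly_complex_of_real)

lemma alg_multiplicity_eq_order:
  assumes "B \<in> carrier_mat n n"
  shows "alg_multiplicity B z = Polynomial.order z (map_poly complex_of_real (char_poly B))"
  unfolding alg_multiplicity_def by (simp add: char_poly_complex_of_real[OF assms])

lemma
  assumes "similar_mat A B"
  shows complex_spectrum_similar: "complex_spectrum A = complex_spectrum B"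
    and alg_multiplicity_similar: "alg_multiplicity A z = alg_multiplicity B z"
proof -
  obtain n where A: "A \<in> carrier_mat n n" and B: "B \<in> carrier_mat n n"
    using similar_matD[OF assms] by auto
  note eq = char_poly_similar[OF assms]
  show "complex_spectrum A = complex_spectrum B"
    unfolding complex_spectrum_eq_roots[OF A] complex_spectrum_eq_roots[OF B] eq ..
  show "alg_multiplicity A z = alg_multiplicity B z"
    unfolding alg_multiplicity_eq_order[OF A] alg_multiplicity_eq_order[OF B] eq ..
qed

text \<open>The matrix xI - T inherits the zero lower left block, and its determinant is the product
  of the determinants of its diagonal blocks.\<close>

lemma char_poly_four_block_lower_left_zero:
  fixes B :: "'a::idom mat"
  assumes B: "B \<in> carrier_mat m m" and C: "C \<in> carrier_mat m k" and D: "D \<in> carrier_mat k k"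
  shows "char_poly (four_block_mat B C (0\<^sub>m k m) D) = char_poly B * char_poly D"
proof -
  have "char_poly_matrix (four_block_mat B C (0\<^sub>m k m) D) =
    four_block_mat (char_poly_matrix B) (map_mat (\<lambda>a. [:- a:]) C) (0\<^sub>m k m) (char_poly_matrix D)"
    using assms by (intro eq_matI) (auto simp: char_poly_matrix_def one_poly_def)
  then show ?thesis unfolding char_poly_def
    using assms by (simp add: det_four_block_mat_lower_left_zero[of _ m _ k])
qed

lemma
  assumes B: "B \<in> carrier_mat m m" and C: "C \<in> carrier_mat m k" and D: "D \<in> carrier_mat k k"
  shows complex_spectrum_four_block:
      "complex_spectrum (four_block_mat B C (0\<^sub>m k m) D) = complex_spectrum B \<union> complex_spectrum D"
    and alg_multiplicity_four_block:
      "alg_multiplicity (four_block_mat B C (0\<^sub>m k m) D) z = alg_multiplicity B z + alg_multiplicity D z"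
proof -
  let ?p = "\<lambda>B. map_poly complex_of_real (char_poly B)"
  let ?T = "four_block_mat B C (0\<^sub>m k m) D"
  have T: "?T \<in> carrier_mat (m + k) (m + k)" using assms by auto
  \<comment> \<open>Characteristic polynomials are monic, hence nonzero; this is what makes the
    order of a root additive on their product.\<close>
  have nz: "?p B \<noteq> 0" if "B \<in> carrier_mat n n" for B and n :: nat
    using degree_monic_char_poly[OF that] by auto
  interpret hom: map_poly_comm_ring_hom complex_of_real ..
  have prod: "?p ?T = ?p B * ?p D"
    using char_poly_four_block_lower_left_zero[OF assms] by (simp add: hom.hom_mult)
  show "complex_spectrum ?T = complex_spectrum B \<union> complex_spectrum D"
    unfolding complex_spectrum_eq_roots[OF T] complex_spectrum_eq_roots[OF B]
      complex_spectrum_eq_roots[OF D] prod by auto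
  show "alg_multiplicity ?T z = alg_multiplicity B z + alg_multiplicity D z"
    unfolding alg_multiplicity_eq_order[OF T] alg_multiplicity_eq_order[OF B]
      alg_multiplicity_eq_order[OF D] prod using nz[OF B] nz[OF D] by (simp add: order_mult)
qed

lemma complex_spectrum_1x1:
  assumes "B \<in> carrier_mat 1 1"
  shows "complex_spectrum B = {complex_of_real (B $$ (0,0))}"
proof -
  have "char_poly B = [:- (B $$ (0,0)), 1:]"
    unfolding char_poly_def using assms by (subst det_single) (auto simp: char_poly_matrix_def)
  then show ?thesis unfolding complex_spectrum_eq_roots[OF assms] by auto
qed

lemma det_2x2:
  assumes A: "A \<in> carrier_mat 2 2"
  shows "det A = A $$ (0,0) * A $$ (1,1) - A $$ (0,1) * A $$ (1,0)"
proof -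
  have "det A = (\<Sum>j<2. A $$ (0,j) * cofactor A 0 j)"
    using laplace_expansion_row[OF A, of 0] by simp
  moreover have "det (mat_delete A 0 j) = A $$ (1, 1 - j)" if "j < 2" for j
    using A that by (subst det_single) (auto simp: mat_delete_def less_2_cases_iff)
  ultimately show ?thesis by (simp add: numeral_2_eq_2 cofactor_def)
qed

text \<open>This is the matrix by which a real matrix acts on the real and imaginary part of an
  eigenvector for \<open>Complex a b\<close>. Its characteristic polynomial is (x - a)^2 +
  b^2.\<close>

lemma complex_spectrum_rotation:
  defines "B \<equiv> \<lambda>a b. mat 2 2 (\<lambda>(i,j). if i = j then a else if i = 0 then b else - b)"
  shows "complex_spectrum (B a b) = {Complex a b, cnj (Complex a b)}"
proof -
  let ?C = "map_mat complex_of_real (B a b)"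
  have C: "?C \<in> carrier_mat 2 2" by (simp add: B_def)
  have "poly (char_poly ?C) x = (x - Complex a b) * (x - cnj (Complex a b))" for x
  proof -
    have "poly (char_poly ?C) x = det (- char_matrix ?C x)"
      by (rule char_poly_matrix[OF C])
    also have "\<dots> = (x - complex_of_real a) * (x - complex_of_real a) + complex_of_real b * complex_of_real b"
      by (subst det_2x2) (auto simp: B_def char_matrix_def algebra_simps)
    also have "\<dots> = (x - Complex a b) * (x - cnj (Complex a b))"
      by (simp add: complex_eq_iff algebra_simps)
    finally show ?thesis .
  qed
  then show ?thesis unfolding spectrum_root_char_poly[OF C] by auto
qed

section \<open>Existence of a real quasi-triangular form\<close>

text \<open>A leading block is added at each step, which matches both deflation and inductions over
  four-block matrices. A 2 x 2 block is constrained through its spectrum instead of its entries,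
  because triangular recombination later replaces each diagonal block by a similar one.\<close>

inductive real_schur :: "nat list \<Rightarrow> real mat \<Rightarrow> bool" where
  Nil: "T \<in> carrier_mat 0 0 \<Longrightarrow> real_schur [] T"
| Cons: "real_schur ms D \<Longrightarrow> D \<in> carrier_mat k k \<Longrightarrow> B \<in> carrier_mat m m \<Longrightarrow> C \<in> carrier_mat m k \<Longrightarrow>
    m = 1 \<or> m = 2 \<and> (\<exists>z. Im z \<noteq> 0 \<and> complex_spectrum B = {z, cnj z}) \<Longrightarrow>
    real_schur (m # ms) (four_block_mat B C (0\<^sub>m k m) D)"

lemma real_schur_carrier: "real_schur ms T \<Longrightarrow> T \<in> carrier_mat (sum_list ms) (sum_list ms)"
  by (induction rule: real_schur.induct) auto

text \<open>Write a complex eigenvector as w = u + iv and its eigenvalue as a + ib; the real and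
  imaginary parts of the eigenvalue equation describe \<open>A\<close> on u and v. If b = 0,
  whichever of u and v is nonzero is a real eigenvector. If b is nonzero, u and v are linearly
  independent.\<close>

lemma ex_real_eigenspace:
  fixes A :: "real mat"
  assumes A: "A \<in> carrier_mat n n" and n: "n \<noteq> 0"
  obtains (real) u x where "u \<in> carrier_vec n" "u \<noteq> 0\<^sub>v n" "A *\<^sub>v u = x \<cdot>\<^sub>v u"
  | (complex) u v a b where "u \<in> carrier_vec n" "v \<in> carrier_vec n" "b \<noteq> 0" "u \<noteq> 0\<^sub>v n"
    "\<And>c. v \<noteq> c \<cdot>\<^sub>v u" "A *\<^sub>v u = a \<cdot>\<^sub>v u - b \<cdot>\<^sub>v v" "A *\<^sub>v v = b \<cdot>\<^sub>v u + a \<cdot>\<^sub>v v"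
proof -
  let ?A = "map_mat complex_of_real A"
  have cA: "?A \<in> carrier_mat n n" using A by auto
  obtain z w where w: "w \<in> carrier_vec n" "w \<noteq> 0\<^sub>v n" "?A *\<^sub>v w = z \<cdot>\<^sub>v w"
    using spectrum_non_empty[OF cA] n cA
    unfolding spectrum_def eigenvalue_def eigenvector_def by auto
  define u where "u = map_vec Re w"
  define v where "v = map_vec Im w"
  define a where "a = Re z"
  define b where "b = Im z"
  have uv: "u \<in> carrier_vec n" "v \<in> carrier_vec n" using w by (auto simp: u_def v_def)
  have entry: "(\<Sum>j<n. complex_of_real (A $$ (i,j)) * w $ j) = z * w $ i" if "i < n" for i
    using arg_cong[OF w(3), of "\<lambda>v. v $ i"] that w(1) A
    by (simp add: scalar_prod_def atLeast0LessThan)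
  have Au: "A *\<^sub>v u = a \<cdot>\<^sub>v u - b \<cdot>\<^sub>v v"
  proof (rule eq_vecI)
    fix i assume "i < dim_vec (a \<cdot>\<^sub>v u - b \<cdot>\<^sub>v v)"
    then have i: "i < n" using uv by auto
    show "(A *\<^sub>v u) $ i = (a \<cdot>\<^sub>v u - b \<cdot>\<^sub>v v) $ i"
      using arg_cong[OF entry[OF i], of Re] i w(1) A
      by (simp add: scalar_prod_def atLeast0LessThan u_def v_def a_def b_def)
  qed (use A uv in auto)
  have Av: "A *\<^sub>v v = b \<cdot>\<^sub>v u + a \<cdot>\<^sub>v v"
  proof (rule eq_vecI)
    fix i assume "i < dim_vec (b \<cdot>\<^sub>v u + a \<cdot>\<^sub>v v)"
    then have i: "i < n" using uv by auto
    show "(A *\<^sub>v v) $ i = (b \<cdot>\<^sub>v u + a \<cdot>\<^sub>v v) $ i"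
      using arg_cong[OF entry[OF i], of Im] i w(1) A
      by (simp add: scalar_prod_def atLeast0LessThan u_def v_def a_def b_def)
  qed (use A uv in auto)
  have uv0: "u \<noteq> 0\<^sub>v n \<or> v \<noteq> 0\<^sub>v n"
  proof (rule ccontr)
    assume "\<not> ?thesis"
    then have "\<And>i. i < n \<Longrightarrow> u $ i = 0" "\<And>i. i < n \<Longrightarrow> v $ i = 0" by auto
    then have "w = 0\<^sub>v n" using w(1) by (intro eq_vecI) (auto simp: u_def v_def complex_eq_iff)
    with w show False by simp
  qed
  show thesis
  proof (cases "b = 0")
    case True
    then have "A *\<^sub>v u = a \<cdot>\<^sub>v u" "A *\<^sub>v v = a \<cdot>\<^sub>v v" using Au Av uv by auto
    then show thesis using real uv uv0 by blast
  next
    case b: False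
    \<comment> \<open>If u vanished, the first equation would read bv = 0, and w would be
      zero.\<close>
    have u0: "u \<noteq> 0\<^sub>v n"
    proof
      assume u0: "u = 0\<^sub>v n"
      have "b * v $ i = 0" if "i < n" for i
        using arg_cong[OF Au, of "\<lambda>v. v $ i"] that u0 uv A by (simp add: scalar_prod_def)
      then have "v = 0\<^sub>v n" using b uv by (intro eq_vecI) auto
      with u0 uv0 show False by simp
    qed
    \<comment> \<open>If v = cu, the two resulting expressions for Av agree only if b(1 + c^2)u = 0,
      and 1 + c^2 is positive.\<close>
    moreover have "v \<noteq> c \<cdot>\<^sub>v u" for c
    proof
      assume v: "v = c \<cdot>\<^sub>v u"
      obtain i where i: "i < n" "u $ i \<noteq> 0" using u0 uv by (metis carrier_vecD eq_vecI index_zero_vec)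
      have "A *\<^sub>v v = c \<cdot>\<^sub>v (A *\<^sub>v u)" unfolding v using A uv by (simp add: mult_mat_vec)
      then have "(b \<cdot>\<^sub>v u + a \<cdot>\<^sub>v v) $ i = (c \<cdot>\<^sub>v (a \<cdot>\<^sub>v u - b \<cdot>\<^sub>v v)) $ i"
        unfolding Au Av by simp
      then have "b * u $ i + a * (c * u $ i) = c * (a * u $ i - b * (c * u $ i))"
        using i uv v by simp
      then have "b * u $ i * (1 + c * c) = 0" by (simp add: algebra_simps)
      moreover have "1 + c * c > 0" by (simp add: add_pos_nonneg)
      ultimately show False using b i by auto
    qed
    ultimately show thesis using complex uv b Au Av by blast
  qed
qed

text \<open>Strong induction on the size: an invariant subspace of dimension 1 or 2 is split off by
  \<open>deflation\<close>, and the remaining block \<open>D\<close> is smaller by that dimension.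
  Strong induction is used since the size may drop by 2.\<close>

lemma ex_real_schur_form:
  assumes "A \<in> carrier_mat n n"
  shows "\<exists>ms T P Q. similar_mat_wit A T P Q \<and> real_schur ms T"
  using assms
proof (induction n arbitrary: A rule: less_induct)
  case (less n)
  \<comment> \<open>The inductive step for an arbitrary admissible leading block \<open>B\<close>,
    shared by the real and the non-real case.\<close>
  have step: ?case if P: "P \<in> carrier_mat n n" "det P \<noteq> 0" and m: "m \<le> n"
    and inv: "\<And>j. j < m \<Longrightarrow> A *\<^sub>v col P j = P *\<^sub>v vec n (\<lambda>i. if i < m then B $$ (i,j) else 0)"
    and B: "B \<in> carrier_mat m m" "m = 1 \<or> m = 2 \<and> (\<exists>z. Im z \<noteq> 0 \<and> complex_spectrum B = {z, cnj z})"
    for m P B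
  proof -
    define k where "k = n - m"
    have n: "n = m + k" using m by (simp add: k_def)
    obtain C D Q where C: "C \<in> carrier_mat m k" and D: "D \<in> carrier_mat k k"
      and wit: "similar_mat_wit A (four_block_mat B C (0\<^sub>m k m) D) P Q"
      using deflation[of A m k P B] less.prems P B inv unfolding n by blast
    have "k < n" using B n by auto
    then obtain ms T R S where T: "similar_mat_wit D T R S" "real_schur ms T"
      using less.IH D by blast
    note T' = similar_mat_witD2[OF D T(1)]
    \<comment> \<open>Conjugation by the block diagonal matrix of the identity and \<open>R\<close>
      turns \<open>D\<close> into \<open>T\<close> and the off-diagonal block \<open>C\<close> into
      \<open>C * R\<close>. These two equations are the off-diagonal part of that
      similarity.\<close>
    have "C = 1\<^sub>m m * (C * R) * S" using C T' by (simp add: assoc_mult_mat[of _ m k _ k _ k])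
    moreover have "0\<^sub>m k m = R * 0\<^sub>m k m * 1\<^sub>m m" using T' by simp
    ultimately have "similar_mat_wit (four_block_mat B C (0\<^sub>m k m) D) (four_block_mat B (C * R) (0\<^sub>m k m) T)
        (four_block_mat (1\<^sub>m m) (0\<^sub>m m k) (0\<^sub>m k m) R) (four_block_mat (1\<^sub>m m) (0\<^sub>m m k) (0\<^sub>m k m) S)"
      using C T' B D by (intro similar_mat_wit_four_block similar_mat_wit_refl T) auto
    moreover have "real_schur (m # ms) (four_block_mat B (C * R) (0\<^sub>m k m) T)"
      using T T' B C by (intro real_schur.Cons) auto
    ultimately show ?thesis using similar_mat_wit_trans[OF wit] by blast
  qed
  show ?case
  proof (cases "n = 0")
    case True
    then show ?thesis using less.prems similar_mat_wit_refl real_schur.Nil by blast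
  next
    case n: False
    show ?thesis
    proof (cases rule: ex_real_eigenspace[OF less.prems n])
      case (1 u x)
      obtain P where P: "P \<in> carrier_mat n n" "det P \<noteq> 0" "col P 0 = u"
        using ex_nonsingular_col[OF 1(1,2)] by blast
      have "vec n (\<lambda>i. if i < 1 then mat 1 1 (\<lambda>_. x) $$ (i,0) else 0) = x \<cdot>\<^sub>v unit_vec n 0"
        using n by (intro eq_vecI) auto
      then show ?thesis
        using n P 1 by (intro step[of P 1 "mat 1 1 (\<lambda>_. x)"]) (auto simp: mult_mat_vec mat_mult_unit_vec)
    next
      case (2 u v a b)
      obtain P where P: "P \<in> carrier_mat n n" "2 \<le> n" "det P \<noteq> 0" "col P 0 = u" "col P 1 = v"
        using ex_nonsingular_two_cols[OF 2(1,4,2,5)] by blast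
      define B where "B = mat 2 2 (\<lambda>(i,j). if i = j then a else if i = 0 then b else - b)"
      \<comment> \<open>The padded columns of \<open>B\<close> are written in unit vectors, so that
        \<open>P\<close> maps them to au - bv and bu + av, the images of u and v under
        \<open>A\<close>.\<close>
      have "vec n (\<lambda>i. if i < 2 then B $$ (i,0) else 0) = a \<cdot>\<^sub>v unit_vec n 0 - b \<cdot>\<^sub>v unit_vec n 1"
        "vec n (\<lambda>i. if i < 2 then B $$ (i,Suc 0) else 0) = b \<cdot>\<^sub>v unit_vec n 0 + a \<cdot>\<^sub>v unit_vec n 1"
        using P(2) by (auto intro!: eq_vecI simp: B_def)
      then have inv: "A *\<^sub>v col P j = P *\<^sub>v vec n (\<lambda>i. if i < 2 then B $$ (i,j) else 0)" if "j < 2" for j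
        using that P 2 n
        by (auto simp: less_2_cases_iff mult_minus_distrib_mat_vec[of _ n n] mult_add_distrib_mat_vec[of _ n n]
            mult_mat_vec mat_mult_unit_vec)
      have "Im (Complex a b) \<noteq> 0 \<and> complex_spectrum B = {Complex a b, cnj (Complex a b)}"
        using complex_spectrum_rotation 2(3) unfolding B_def by simp
      then have "2 = 1 \<or> 2 = 2 \<and> (\<exists>z. Im z \<noteq> 0 \<and> complex_spectrum B = {z, cnj z})" by blast
      moreover have "B \<in> carrier_mat 2 2" by (simp add: B_def)
      ultimately show ?thesis using inv P(1-3) step by blast
    qed
  qed
qed

section \<open>Triangular recombination and Cholesky factorisation\<close>

lemma upper_triangular_split:
  assumes R: "R \<in> carrier_mat (m + k) (m + k)" "upper_triangular R"
  obtains R1 R2 R3 where "R = four_block_mat R1 R2 (0\<^sub>m k m) R3"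
    "R1 \<in> carrier_mat m m" "R2 \<in> carrier_mat m k" "R3 \<in> carrier_mat k k"
    "upper_triangular R1" "upper_triangular R3"
proof
  show "R = four_block_mat (mat m m (\<lambda>(i,j). R $$ (i,j))) (mat m k (\<lambda>(i,j). R $$ (i, m + j)))
    (0\<^sub>m k m) (mat k k (\<lambda>(i,j). R $$ (m + i, m + j)))"
    using R by (intro eq_matI) auto
  show "upper_triangular (mat m m (\<lambda>(i,j). R $$ (i,j)))"
    "upper_triangular (mat k k (\<lambda>(i,j). R $$ (m + i, m + j)))"
    using R upper_triangularD[OF R(2)] by (auto intro!: upper_triangularI)
qed auto

lemma four_block_mat_diag_eqD:
  assumes "four_block_mat A B C D = four_block_mat A' B' C' D'"
    and A: "A \<in> carrier_mat m m" and A': "A' \<in> carrier_mat m m"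
    and D: "D \<in> carrier_mat k k" and D': "D' \<in> carrier_mat k k"
  shows "A = A'" "D = D'"
proof -
  have entry: "four_block_mat A B C D $$ (i,j) = four_block_mat A' B' C' D' $$ (i,j)" for i j
    using assms(1) by simp
  show "A = A'"
  proof (rule eq_matI)
    fix i j assume "i < dim_row A'" "j < dim_col A'"
    then show "A $$ (i,j) = A' $$ (i,j)" using entry[of i j] A A' D D' by simp
  qed (use A A' in auto)
  show "D = D'"
  proof (rule eq_matI)
    fix i j assume "i < dim_row D'" "j < dim_col D'"
    then show "D $$ (i,j) = D' $$ (i,j)" using entry[of "m + i" "m + j"] A A' D D' by simp
  qed (use D D' in auto)
qed

text \<open>Back substitution, from the last row upwards: below the diagonal, entry (i,j) of
  \<open>R * Q\<close> reduces to the product of the diagonal entry of \<open>R\<close> with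
  \<open>Q $$ (i,j)\<close>, once the entries of \<open>Q\<close> further down in column j are known
  to vanish. The diagonal of \<open>R\<close> is nonzero because its determinant is.\<close>

lemma upper_triangular_inverse:
  fixes R :: "'a::idom mat"
  assumes R: "R \<in> carrier_mat n n" "upper_triangular R" and Q: "Q \<in> carrier_mat n n"
    and inv: "R * Q = 1\<^sub>m n"
  shows "upper_triangular Q"
proof -
  have "det R * det Q = 1" using det_mult[OF R(1) Q] inv by simp
  then have "det R \<noteq> 0" by auto
  then have diag: "R $$ (i,i) \<noteq> 0" if "i < n" for i
    using upper_triangular_imp_det_eq_0_iff[OF R] R(1) that by (auto simp: diag_mat_def)
  have "Q $$ (i,j) = 0" if "j < i" "i < n" for i j
    using that
  proof (induction "n - i" arbitrary: i rule: less_induct)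
    case less
    have below: "Q $$ (k,j) = 0" if "i < k" "k < n" for k
      using less that by (intro less.hyps) auto
    have "(\<Sum>k<n. R $$ (i,k) * Q $$ (k,j)) = (R * Q) $$ (i,j)"
      using less.prems R Q by (simp add: scalar_prod_def atLeast0LessThan)
    also have "\<dots> = 0" using inv less.prems by simp
    also have "(\<Sum>k<n. R $$ (i,k) * Q $$ (k,j)) = (\<Sum>k<n. if k = i then R $$ (i,i) * Q $$ (i,j) else 0)"
    proof (rule sum.cong)
      fix k assume "k \<in> {..<n}"
      then show "R $$ (i,k) * Q $$ (k,j) = (if k = i then R $$ (i,i) * Q $$ (i,j) else 0)"
        using below[of k] upper_triangularD[OF R(2), of k i] R(1) less.prems
        by (cases k i rule: linorder_cases) auto
    qed simp
    finally show ?case using diag less.prems by simp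
  qed
  then show ?thesis using Q by auto
qed

text \<open>An upper triangular matrix is block upper triangular for every partition, so the block
  shape survives. Each diagonal block is conjugated by mutually inverse diagonal blocks of
  \<open>U\<close> and \<open>V\<close>, which preserves its spectrum.\<close>

lemma real_schur_upper_triangular_conj:
  assumes "real_schur ms T" "n = sum_list ms"
    and "U \<in> carrier_mat n n" "V \<in> carrier_mat n n"
    and "upper_triangular U" "upper_triangular V" "U * V = 1\<^sub>m n"
  shows "real_schur ms (U * T * V)"
  using assms
proof (induction arbitrary: U V n rule: real_schur.induct)
  case (Nil T)
  then show ?case by (auto intro: real_schur.Nil)
next
  case (Cons ms D k B m C)
  have k: "k = sum_list ms" using real_schur_carrier[OF Cons.hyps(1)] Cons.hyps(2) by auto
  have n: "n = m + k" using Cons.prems(1) k by simp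
  obtain U1 U2 U3 where U: "U = four_block_mat U1 U2 (0\<^sub>m k m) U3"
    "U1 \<in> carrier_mat m m" "U2 \<in> carrier_mat m k" "U3 \<in> carrier_mat k k" "upper_triangular U3"
    using upper_triangular_split[of U m k] Cons.prems unfolding n by metis
  obtain V1 V2 V3 where V: "V = four_block_mat V1 V2 (0\<^sub>m k m) V3"
    "V1 \<in> carrier_mat m m" "V2 \<in> carrier_mat m k" "V3 \<in> carrier_mat k k" "upper_triangular V3"
    using upper_triangular_split[of V m k] Cons.prems unfolding n by metis
  \<comment> \<open>Comparing the diagonal blocks of \<open>U * V\<close> with those of the identity
    shows that \<open>U1\<close>, \<open>V1\<close> and \<open>U3\<close>, \<open>V3\<close> are
    inverse pairs.\<close>
  have "four_block_mat (U1 * V1) (U1 * V2 + U2 * V3) (0\<^sub>m k m) (U3 * V3) = U * V"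
    unfolding U V using U(2-4) V(2-4)
    by (subst mult_four_block_mat[of _ m m _ k _ k _ _ m _ k]) auto
  also have "\<dots> = four_block_mat (1\<^sub>m m) (0\<^sub>m m k) (0\<^sub>m k m) (1\<^sub>m k)"
    using Cons.prems(6) n by simp
  finally have UV: "U1 * V1 = 1\<^sub>m m" "U3 * V3 = 1\<^sub>m k"
    by (rule four_block_mat_diag_eqD[of _ _ _ _ _ _ _ _ m k]; use U V in auto)+
  define X where "X = U1 * B * V2 + (U1 * C + U2 * D) * V3"
  have "U * four_block_mat B C (0\<^sub>m k m) D =
      four_block_mat (U1 * B) (U1 * C + U2 * D) (0\<^sub>m k m) (U3 * D)"
    unfolding U using U(2-4) Cons.hyps(2-4)
    by (subst mult_four_block_mat[of _ m m _ k _ k _ _ m _ k]) auto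
  then have eq: "U * four_block_mat B C (0\<^sub>m k m) D * V =
      four_block_mat (U1 * B * V1) X (0\<^sub>m k m) (U3 * D * V3)"
    unfolding V X_def using U(2-4) V(2-4) Cons.hyps(2-4)
    by (simp, subst mult_four_block_mat[of _ m m _ k _ k _ _ m _ k]) auto
  have "V1 * U1 = 1\<^sub>m m" using mat_mult_left_right_inverse UV U V by blast
  then have "similar_mat (U1 * B * V1) B"
    using UV U V Cons.hyps by (intro similar_matI[of _ _ U1 V1 m]) auto
  then have "complex_spectrum (U1 * B * V1) = complex_spectrum B" by (rule complex_spectrum_similar)
  then show ?case unfolding eq
    using U V Cons.hyps(2-5) Cons.IH[OF k U(4) V(4) U(5) V(5) UV(2)]
    by (intro real_schur.Cons) (auto simp: X_def)
qed

section \<open>Positive definite matrices and Cholesky factorisation\<close>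

definition pos_def :: "real mat \<Rightarrow> bool" where
  "pos_def G \<longleftrightarrow> transpose_mat G = G \<and>
    (\<forall>x \<in> carrier_vec (dim_row G). x \<noteq> 0\<^sub>v (dim_row G) \<longrightarrow> x \<bullet> (G *\<^sub>v x) > 0)"

text \<open>Induction via the Schur complement. For G with corner g, remaining first row c and
  remaining block H, the matrix K = H - c^T c / g is again positive definite. A factor
  \<open>R\<close> of K is bordered by the first row (sqrt g, c / sqrt g) to give a factor of
  G.\<close>

lemma cholesky:
  assumes "G \<in> carrier_mat n n" "pos_def G"
  shows "\<exists>R \<in> carrier_mat n n. upper_triangular R \<and> det R \<noteq> 0 \<and> transpose_mat R * R = G"
  using assms
proof (induction n arbitrary: G)
  case 0
  then show ?case by (intro bexI[of _ "0\<^sub>m 0 0"]) auto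
next
  case (Suc m)
  note G = Suc.prems(1)
  have sym: "transpose_mat G = G"
    and pos: "\<And>x. x \<in> carrier_vec (Suc m) \<Longrightarrow> x \<noteq> 0\<^sub>v (Suc m) \<Longrightarrow> x \<bullet> (G *\<^sub>v x) > 0"
    using Suc.prems by (auto simp: pos_def_def)
  define g where "g = G $$ (0,0)"
  define c where "c = mat 1 m (\<lambda>(i,j). G $$ (0, Suc j))"
  define H where "H = mat m m (\<lambda>(i,j). G $$ (Suc i, Suc j))"
  have carr: "c \<in> carrier_mat 1 m" "H \<in> carrier_mat m m" by (auto simp: c_def H_def)
  have sym': "G $$ (i,j) = G $$ (j,i)" if "i < Suc m" "j < Suc m" for i j
    using arg_cong[OF sym, of "\<lambda>M. M $$ (j,i)"] that G by simp
  have col0: "G $$ (i,0) = G $$ (0,i)" if "0 < i" "i < Suc m" for i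
    using sym' that by simp
  have G_eq: "G = four_block_mat (mat 1 1 (\<lambda>_. g)) c (transpose_mat c) H"
    using G by (intro eq_matI) (auto simp: c_def H_def g_def col0)
  \<comment> \<open>The corner g is the value of the quadratic form at the first unit
    vector.\<close>
  have "unit_vec (Suc m) 0 \<noteq> (0\<^sub>v (Suc m) :: real vec)"
    by (metis index_unit_vec(1) index_zero_vec(1) zero_less_Suc zero_neq_one)
  then have g: "g > 0" using pos[of "unit_vec (Suc m) 0"] G
      scalar_prod_left_unit[of "col G 0" "Suc m" 0] by (simp add: mat_mult_unit_vec g_def)
  define K where "K = H - (1 / g) \<cdot>\<^sub>m (transpose_mat c * c)"
  have K: "K \<in> carrier_mat m m" using carr unfolding K_def by auto
  have K_entry: "K $$ (i,j) = G $$ (Suc i, Suc j) - G $$ (0, Suc i) * G $$ (0, Suc j) / g" if "i < m" "j < m" for i j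
    using that carr unfolding K_def by (simp add: H_def c_def scalar_prod_def)
  have "pos_def K"
    unfolding pos_def_def
  proof (intro conjI ballI impI)
    show "transpose_mat K = K"
    proof (rule eq_matI)
      fix i j assume "i < dim_row K" "j < dim_col K"
      then have ij: "i < m" "j < m" using K by auto
      then show "transpose_mat K $$ (i,j) = K $$ (i,j)"
        using K K_entry[OF ij] K_entry[OF ij(2,1)] sym'[of "Suc i" "Suc j"] by simp
    qed (use K in auto)
  next
    fix x :: "real vec" assume "x \<in> carrier_vec (dim_row K)" "x \<noteq> 0\<^sub>v (dim_row K)"
    then have x: "x \<in> carrier_vec m" "x \<noteq> 0\<^sub>v m" using K by auto
    define s where "s = (\<Sum>j<m. G $$ (0, Suc j) * x $ j)"
    \<comment> \<open>The first coordinate \<open>- s / g\<close> minimises the quadratic form of \<open>G\<close> over all extensions of \<open>x\<close>.\<close>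
    define y where "y = vec (Suc m) (\<lambda>i. if i = 0 then - s / g else x $ (i - 1))"
    have y: "y \<in> carrier_vec (Suc m)" by (simp add: y_def)
    obtain i where "i < m" "x $ i \<noteq> 0" using x by (metis carrier_vecD eq_vecI index_zero_vec)
    then have "y $ Suc i \<noteq> 0" by (simp add: y_def)
    then have "y \<noteq> 0\<^sub>v (Suc m)" using \<open>i < m\<close> by auto
    then have "0 < y \<bullet> (G *\<^sub>v y)" using pos y by blast
    also have "\<dots> = (\<Sum>i<Suc m. y $ i * (\<Sum>j<Suc m. G $$ (i,j) * y $ j))"
      using G y by (simp add: scalar_prod_def atLeast0LessThan)
    also have "\<dots> = (\<Sum>i<m. x $ i * (\<Sum>j<m. K $$ (i,j) * x $ j))"
    proof -
      \<comment> \<open>By the choice of the first coordinate of y, the vector Gy has first entry 0,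
        and its other entries are those of Kx. Hence both quadratic forms take the same
        value.\<close>
      have row: "(\<Sum>j<Suc m. G $$ (i,j) * y $ j) = (if i = 0 then 0 else \<Sum>j<m. K $$ (i - 1,j) * x $ j)"
        if "i < Suc m" for i
      proof -
        have eq: "(\<Sum>j<Suc m. G $$ (i,j) * y $ j) = - G $$ (i,0) * s / g + (\<Sum>j<m. G $$ (i,Suc j) * x $ j)"
          by (subst sum.lessThan_Suc_shift) (simp add: y_def)
        show ?thesis
        proof (cases i)
          case 0
          then show ?thesis using eq g by (simp add: s_def g_def[symmetric])
        next
          case (Suc l)
          have "(\<Sum>j<m. K $$ (l,j) * x $ j) = (\<Sum>j<m. G $$ (i,Suc j) * x $ j - G $$ (0,i) / g * (G $$ (0,Suc j) * x $ j))"
            using Suc that by (intro sum.cong) (auto simp: K_entry algebra_simps)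
          also have "\<dots> = (\<Sum>j<m. G $$ (i,Suc j) * x $ j) - G $$ (0,i) / g * s"
            by (simp add: sum_subtractf s_def sum_distrib_left)
          finally show ?thesis using eq Suc sym'[of i 0] that by simp
        qed
      qed
      have "(\<Sum>i<Suc m. y $ i * (\<Sum>j<Suc m. G $$ (i,j) * y $ j)) =
          (\<Sum>i<Suc m. y $ i * (if i = 0 then 0 else \<Sum>j<m. K $$ (i - 1,j) * x $ j))"
        by (intro sum.cong refl arg_cong2[of _ _ _ _ "(*)"] row) auto
      also have "\<dots> = (\<Sum>i<m. x $ i * (\<Sum>j<m. K $$ (i,j) * x $ j))"
        by (subst sum.lessThan_Suc_shift) (simp add: y_def)
      finally show ?thesis .
    qed
    also have "\<dots> = x \<bullet> (K *\<^sub>v x)"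
      using K x by (simp add: scalar_prod_def atLeast0LessThan)
    finally show "x \<bullet> (K *\<^sub>v x) > 0" .
  qed
  then obtain R where R: "R \<in> carrier_mat m m" "upper_triangular R" "det R \<noteq> 0" "transpose_mat R * R = K"
    using Suc.IH[OF K] by blast
  let ?a = "mat 1 1 (\<lambda>_. sqrt g)"
  let ?R = "four_block_mat ?a ((1 / sqrt g) \<cdot>\<^sub>m c) (0\<^sub>m m 1) R"
  have "det ?R = det ?a * det R"
    using carr R by (intro det_four_block_mat_lower_left_zero) auto
  also have "det ?a = sqrt g" by (subst det_single) auto
  finally have det: "det ?R \<noteq> 0" using g R by simp
  have ut: "upper_triangular ?R"
    using R by (intro upper_triangular_four_block) auto
  have "transpose_mat ?R = four_block_mat ?a (0\<^sub>m 1 m) ((1 / sqrt g) \<cdot>\<^sub>m transpose_mat c) (transpose_mat R)"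
    using carr R by (intro eq_matI) auto
  then have "transpose_mat ?R * ?R =
      four_block_mat ?a (0\<^sub>m 1 m) ((1 / sqrt g) \<cdot>\<^sub>m transpose_mat c) (transpose_mat R) * ?R" by simp
  also have "\<dots> = four_block_mat (mat 1 1 (\<lambda>_. g)) c (transpose_mat c) ((1 / g) \<cdot>\<^sub>m (transpose_mat c * c) + K)"
    using carr R g
    by (subst mult_four_block_mat[of _ 1 1 _ m _ m _ _ 1 _ m])
      (auto intro!: cong_four_block_mat eq_matI simp: scalar_prod_def)
  also have "(1 / g) \<cdot>\<^sub>m (transpose_mat c * c) + K = H"
    unfolding K_def using carr by (intro eq_matI) auto
  finally have "transpose_mat ?R * ?R = G" unfolding G_eq .
  moreover have "?R \<in> carrier_mat (Suc m) (Suc m)" using R carr by auto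
  ultimately show ?case using det ut by blast
qed

section \<open>Equiangular Gram matrices and blocks\<close>

lemma scalar_prod_self_pos:
  fixes v :: "real vec"
  assumes "v \<in> carrier_vec n" "v \<noteq> 0\<^sub>v n"
  shows "v \<bullet> v > 0"
proof -
  obtain i where i: "i < n" "v $ i \<noteq> 0" using assms by (metis carrier_vecD eq_vecI index_zero_vec)
  then have "0 < (\<Sum>i<n. v $ i * v $ i)"
    by (intro sum_pos2[of _ i]) (auto simp: not_sum_squares_lt_zero zero_less_mult_iff)
  then show ?thesis using assms by (simp add: scalar_prod_def atLeast0LessThan)
qed

text \<open>The quadratic form at x is the squared length of Px, and Px is nonzero because P is
  injective.\<close>

lemma pos_def_gram:
  fixes P :: "real mat"
  assumes P: "P \<in> carrier_mat n n" and det: "det P \<noteq> 0"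
  shows "pos_def (transpose_mat P * P)"
  unfolding pos_def_def
proof (intro conjI ballI impI)
  show "transpose_mat (transpose_mat P * P) = transpose_mat P * P"
    using P by (simp add: transpose_mult[of _ n n _ n])
next
  fix x :: "real vec"
  assume "x \<in> carrier_vec (dim_row (transpose_mat P * P))" "x \<noteq> 0\<^sub>v (dim_row (transpose_mat P * P))"
  then have x: "x \<in> carrier_vec n" "x \<noteq> 0\<^sub>v n" using P by auto
  obtain Q where Q: "Q \<in> carrier_mat n n" "Q * P = 1\<^sub>m n" using obtain_inverse_mat[OF P det] by metis
  have Px: "P *\<^sub>v x \<in> carrier_vec n" using P x by auto
  have "P *\<^sub>v x \<noteq> 0\<^sub>v n"
  proof
    assume "P *\<^sub>v x = 0\<^sub>v n"
    then have "Q *\<^sub>v (P *\<^sub>v x) = 0\<^sub>v n" using Q by (intro eq_vecI) (auto simp: scalar_prod_def)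
    then show False using x Q P by (simp add: assoc_mult_mat_vec[symmetric, of _ n n _ n])
  qed
  then have "0 < (P *\<^sub>v x) \<bullet> (P *\<^sub>v x)" using scalar_prod_self_pos[OF Px] by blast
  also have "\<dots> = (transpose_mat P *\<^sub>v (P *\<^sub>v x)) \<bullet> x"
    using transpose_vec_mult_scalar[OF P x(1) Px] by simp
  also have "\<dots> = x \<bullet> (transpose_mat P * P *\<^sub>v x)"
    using P x Px by (subst comm_scalar_prod[of _ n]) (auto simp: assoc_mult_mat_vec[of _ n n _ n])
  finally show "0 < x \<bullet> (transpose_mat P * P *\<^sub>v x)" .
qed

definition equiangular_gram :: "nat \<Rightarrow> real \<Rightarrow> real mat" where
  "equiangular_gram n \<alpha> = mat n n (\<lambda>(i,j). if i = j then 1 else \<alpha>)"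

text \<open>With q the squared length of x and s the sum of its entries, the quadratic form is (1 -
  \<alpha>)q + \<alpha>s^2. For \<alpha> \<ge> 0 the first term is positive. For \<alpha> < 0, the
  bound s^2 \<le> nq leaves at least (1 + \<alpha>(n - 1))q, which is positive by the lower bound on
  \<alpha>.\<close>

lemma pos_def_equiangular_gram:
  assumes n: "2 \<le> n" and \<alpha>: "- 1 / (real n - 1) < \<alpha>" "\<alpha> < 1"
  shows "pos_def (equiangular_gram n \<alpha>)"
  unfolding pos_def_def
proof (intro conjI ballI impI)
  show "transpose_mat (equiangular_gram n \<alpha>) = equiangular_gram n \<alpha>"
    by (rule eq_matI) (auto simp: equiangular_gram_def)
next
  fix x :: "real vec"
  assume "x \<in> carrier_vec (dim_row (equiangular_gram n \<alpha>))" "x \<noteq> 0\<^sub>v (dim_row (equiangular_gram n \<alpha>))"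
  then have x: "x \<in> carrier_vec n" "x \<noteq> 0\<^sub>v n" by (auto simp: equiangular_gram_def)
  define q where "q = (\<Sum>i<n. x $ i * x $ i)"
  define s where "s = (\<Sum>i<n. x $ i)"
  have q: "q > 0" using scalar_prod_self_pos[OF x] x
    by (simp add: q_def scalar_prod_def atLeast0LessThan)
  have row: "(\<Sum>j<n. (if i = j then 1 else \<alpha>) * x $ j) = (1 - \<alpha>) * x $ i + \<alpha> * s" if "i < n" for i
  proof -
    have "(\<Sum>j<n. (if i = j then 1 else \<alpha>) * x $ j) =
        (\<Sum>j<n. (if i = j then (1 - \<alpha>) * x $ i else 0) + \<alpha> * x $ j)"
      by (intro sum.cong) (auto simp: algebra_simps)
    then show ?thesis using that by (simp add: sum.distrib s_def sum_distrib_left)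
  qed
  have "x \<bullet> (equiangular_gram n \<alpha> *\<^sub>v x) = (\<Sum>i<n. x $ i * (\<Sum>j<n. (if i = j then 1 else \<alpha>) * x $ j))"
    using x by (simp add: equiangular_gram_def scalar_prod_def atLeast0LessThan)
  also have "\<dots> = (\<Sum>i<n. (1 - \<alpha>) * (x $ i * x $ i) + \<alpha> * s * x $ i)"
    by (intro sum.cong refl) (simp add: row, simp add: algebra_simps)
  also have "\<dots> = (1 - \<alpha>) * q + \<alpha> * s * s"
    unfolding sum.distrib q_def by (simp add: s_def sum_distrib_left)
  finally have form: "x \<bullet> (equiangular_gram n \<alpha> *\<^sub>v x) = (1 - \<alpha>) * q + \<alpha> * s * s" .
  \<comment> \<open>The squared deviations from the mean s / n sum to q - s^2 / n, which gives the
    Cauchy-Schwarz bound s^2 \<le> nq.\<close>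
  have "0 \<le> (\<Sum>i<n. (x $ i - s / n) * (x $ i - s / n))" by (intro sum_nonneg) simp
  also have "\<dots> = (\<Sum>i<n. x $ i * x $ i - 2 * (s / n) * x $ i + (s / n) * (s / n))"
    by (intro sum.cong) (auto simp: algebra_simps)
  also have "\<dots> = q - 2 * (s / n) * s + s / n * (n * (s / n))"
    by (simp only: sum.distrib sum_subtractf q_def s_def sum_distrib_left[symmetric] sum_constant card_lessThan)
  also have "\<dots> = q - s * s / n" using n by (simp add: field_simps)
  finally have cs: "s * s \<le> n * q" using n by (simp add: field_simps)
  show "0 < x \<bullet> (equiangular_gram n \<alpha> *\<^sub>v x)"
  proof (cases "\<alpha> \<ge> 0")
    case True
    have "0 < (1 - \<alpha>) * q" using q \<alpha> by simp
    moreover have "0 \<le> \<alpha> * (s * s)" by (rule mult_nonneg_nonneg[OF True zero_le_square])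
    ultimately show ?thesis unfolding form by (simp add: mult.assoc)
  next
    case False
    have "0 < 1 + \<alpha> * (real n - 1)" using \<alpha> n by (simp add: field_simps)
    then have "0 < (1 + \<alpha> * (real n - 1)) * q" using q by simp
    also have "\<dots> = (1 - \<alpha>) * q + \<alpha> * (n * q)" by (simp add: algebra_simps)
    also have "\<dots> \<le> (1 - \<alpha>) * q + \<alpha> * (s * s)" using cs False by (simp add: mult_left_mono_neg)
    finally show ?thesis unfolding form by (simp add: mult.assoc)
  qed
qed

section \<open>Blocks of a partitioned matrix and the spectral data of the diagonal blocks\<close>

lemma pick_interval:
  assumes "i < b - a"
  shows "pick {a..<b} i = a + i"
proof -
  have "{x \<in> {a..<b}. x < a + i} = {a..<a + i}" using assms by auto
  then show ?thesis using pick_card_in_set[of "a + i" "{a..<b}"] assms by simp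
qed

lemma sum_list_take_Suc:
  "k < length ns \<Longrightarrow> sum_list (take (Suc k) ns) = sum_list (take k ns) + (ns ! k :: nat)"
  by (simp add: take_Suc_conv_app_nth)

lemma sum_list_take_nth_le:
  assumes "k < length ns"
  shows "sum_list (take k ns) + ns ! k \<le> (sum_list ns :: nat)"
proof -
  have "sum_list ns = sum_list (take (Suc k) ns) + sum_list (drop (Suc k) ns)"
    by (metis append_take_drop_id sum_list_append)
  then show ?thesis using sum_list_take_Suc[OF assms] by simp
qed

text \<open>Block ranges are intervals inside the index range of \<open>T\<close>, so the
  cardinalities and the enumeration \<open>pick\<close> behind \<open>submatrix\<close> become block
  sizes and plain index shifts.\<close>

lemma block_eq:
  assumes T: "T \<in> carrier_mat (sum_list ns) (sum_list ns)" and k: "k < length ns" and l: "l < length ns"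
  shows "block ns T k l =
    mat (ns ! k) (ns ! l) (\<lambda>(i,j). T $$ (sum_list (take k ns) + i, sum_list (take l ns) + j))"
proof -
  have card: "card {i. i < sum_list ns \<and> i \<in> block_range ns k} = ns ! k" if "k < length ns" for k
  proof -
    have "{i. i < sum_list ns \<and> i \<in> block_range ns k} = {sum_list (take k ns)..<sum_list (take k ns) + ns ! k}"
      using sum_list_take_nth_le[OF that] sum_list_take_Suc[OF that] by (auto simp: block_range_def)
    then show ?thesis by simp
  qed
  have pick: "pick (block_range ns k) i = sum_list (take k ns) + i" if "k < length ns" "i < ns ! k" for k i
    using that unfolding block_range_def by (subst pick_interval) (auto simp: sum_list_take_Suc)
  show ?thesis unfolding block_def submatrix_def
    using T card[OF k] card[OF l] pick[OF k] pick[OF l] by (intro eq_matI) auto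
qed

text \<open>Prepending \<open>m\<close> to the partition shifts all later block ranges by
  \<open>m\<close>, the offset at which \<open>D\<close> sits in \<open>T\<close>.\<close>

lemma
  assumes B: "B \<in> carrier_mat m m" and C: "C \<in> carrier_mat m k" and D: "D \<in> carrier_mat k k"
    and k: "k = sum_list ms"
  defines "T \<equiv> four_block_mat B C (0\<^sub>m k m) D"
  shows block_four_block_0: "block (m # ms) T 0 0 = B"
    and block_four_block_Suc: "p < length ms \<Longrightarrow> q < length ms \<Longrightarrow>
      block (m # ms) T (Suc p) (Suc q) = block ms D p q"
    and block_four_block_Suc_0: "p < length ms \<Longrightarrow> block (m # ms) T (Suc p) 0 = 0\<^sub>m (ms ! p) m"
proof -
  have T: "T \<in> carrier_mat (sum_list (m # ms)) (sum_list (m # ms))" using B D k by (simp add: T_def)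
  have D': "D \<in> carrier_mat (sum_list ms) (sum_list ms)" using D k by simp
  show "block (m # ms) T 0 0 = B"
    using B D by (subst block_eq[OF T]) (auto simp: T_def intro!: eq_matI)
  show "block (m # ms) T (Suc p) (Suc q) = block ms D p q" if pq: "p < length ms" "q < length ms"
    using B D k pq sum_list_take_nth_le[OF pq(1)] sum_list_take_nth_le[OF pq(2)]
    by (simp add: block_eq[OF T] block_eq[OF D'], intro eq_matI) (auto simp: T_def)
  show "block (m # ms) T (Suc p) 0 = 0\<^sub>m (ms ! p) m" if p: "p < length ms"
    using B D k p sum_list_take_nth_le[OF p]
    by (simp add: block_eq[OF T], intro eq_matI) (auto simp: T_def)
qed

lemma real_schur_block_upper_triangular:
  "real_schur ms T \<Longrightarrow> block_upper_triangular ms T"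
proof (induction rule: real_schur.induct)
  case (Nil T)
  then show ?case by (simp add: block_upper_triangular_def)
next
  case (Cons ms D k B m C)
  have k: "k = sum_list ms" using real_schur_carrier[OF Cons.hyps(1)] Cons.hyps(2) by auto
  note blocks = block_four_block_Suc[OF Cons.hyps(3,4,2) k] block_four_block_Suc_0[OF Cons.hyps(3,4,2) k]
  let ?T = "four_block_mat B C (0\<^sub>m k m) D"
  have "block (m # ms) ?T p q = 0\<^sub>m ((m # ms) ! p) ((m # ms) ! q)"
    if p: "p < length (m # ms)" and q: "q < p" for p q
  proof -
    obtain p' where p': "p = Suc p'" "p' < length ms" using p q by (cases p) auto
    show ?thesis
    proof (cases q)
      case 0
      then show ?thesis using p' by (simp add: blocks)
    next
      case (Suc q')
      then show ?thesis
        using p' q Cons.IH by (simp add: blocks block_upper_triangular_def)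
    qed
  qed
  then show ?case using Cons.hyps k unfolding block_upper_triangular_def by auto
qed

text \<open>Along the construction, each new leading block contributes its spectrum by union and its
  multiplicities by addition, since characteristic polynomials multiply. The induction starts from
  the empty matrix, whose characteristic polynomial is 1 and has no roots.\<close>

lemma real_schur_diagonal_blocks:
  assumes "real_schur ms T"
  shows "set ms \<subseteq> {1, 2}"
    and "complex_spectrum T = (\<Union>k<length ms. complex_spectrum (block ms T k k))"
    and "alg_multiplicity T z = (\<Sum>k<length ms. alg_multiplicity (block ms T k k) z)"
    and "\<forall>k<length ms. block ms T k k \<in> carrier_mat (ms ! k) (ms ! k)"
    and "\<forall>k<length ms. ms ! k = 2 \<longrightarrow>
      (\<exists>z. Im z \<noteq> 0 \<and> complex_spectrum (block ms T k k) = {z, cnj z})"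
  using assms
proof (induction rule: real_schur.induct)
  case (Nil T)
  {
    case 1 show ?case by simp
  next
    case 2
    have "char_poly T = 1" using Nil by (simp add: char_poly_def)
    then show ?case using Nil by (simp add: complex_spectrum_eq_roots[of _ 0])
  next
    case 3
    have "char_poly T = 1" using Nil by (simp add: char_poly_def)
    then show ?case using Nil by (simp add: alg_multiplicity_eq_order[of _ 0] order_1_eq_0)
  next
    case 4 show ?case by simp
  next
    case 5 show ?case by simp
  }
next
  case (Cons ms D k B m C)
  have k: "k = sum_list ms" using real_schur_carrier[OF Cons.hyps(1)] Cons.hyps(2) by auto
  note carr = Cons.hyps(3,4,2)
  note blocks = block_four_block_0[OF carr k] block_four_block_Suc[OF carr k]
  {
    case 1
    show ?case using Cons.IH(1) Cons.hyps(5) by auto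
  next
    case 2
    \<comment> \<open>Index 0 belongs to the new block \<open>B\<close>, and the successors index
      the diagonal blocks of \<open>D\<close>.\<close>
    have "{..<length (m # ms)} = insert 0 (Suc ` {..<length ms})" by (simp add: lessThan_Suc_eq_insert_0)
    then show ?case
      unfolding complex_spectrum_four_block[OF carr] Cons.IH(2) by (simp add: blocks)
  next
    case 3
    show ?case
      unfolding alg_multiplicity_four_block[OF carr] Cons.IH(3)
      by (simp add: blocks sum.lessThan_Suc_shift del: sum.lessThan_Suc)
  next
    case 4
    show ?case using Cons.IH(4) carr by (auto simp: All_less_Suc2 blocks)
  next
    case 5
    have "m = 2 \<longrightarrow> (\<exists>z. Im z \<noteq> 0 \<and> complex_spectrum B = {z, cnj z})" using Cons.hyps(5) by auto
    then show ?case using Cons.IH(5) 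
      unfolding length_Cons All_less_Suc2 nth_Cons_0 nth_Cons_Suc blocks(1) by (simp add: blocks(2))
  }
qed

section \<open>Construction of the equiangular similarity\<close>

theorem proposition3p1:
  fixes n :: nat and \<alpha> :: real and A :: "real mat"
  assumes "n \<ge> 2"
    and "- 1 / (real n - 1) < \<alpha>" and "\<alpha> < 1"
    and "A \<in> carrier_mat n n"
  shows "\<exists>S \<in> EM n \<alpha>. \<exists>S' \<in> carrier_mat n n. \<exists>T \<in> carrier_mat n n. \<exists>ns :: nat list.
     inverts_mat S S' \<and> inverts_mat S' S \<and> S' * A * S = T \<and>
     set ns \<subseteq> {1, 2} \<and> sum_list ns = n \<and> block_upper_triangular ns T \<and>
     complex_spectrum A = (\<Union>k<length ns. complex_spectrum (block ns T k k)) \<and>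
     (\<forall>z. alg_multiplicity A z = (\<Sum>k<length ns. alg_multiplicity (block ns T k k) z)) \<and>
     (\<forall>k<length ns. ns ! k = 1 \<longrightarrow>
        (\<exists>x :: real. complex_spectrum (block ns T k k) = {complex_of_real x})) \<and>
     (\<forall>k<length ns. ns ! k = 2 \<longrightarrow>
        (\<exists>z :: complex. Im z \<noteq> 0 \<and> complex_spectrum (block ns T k k) = {z, cnj z}))"
proof -
  note A = assms(4)
  let ?M = "equiangular_gram n \<alpha>"
  note [simp] = assoc_mult_mat[of _ n n _ n _ n]
  obtain ns T0 P P' where wit: "similar_mat_wit A T0 P P'" and T0_schur: "real_schur ns T0"
    using ex_real_schur_form[OF A] by blast
  note w = similar_mat_witD2[OF A wit]
  note P = w(6) and P' = w(7) and T0 = w(5)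
  have ns: "sum_list ns = n" using real_schur_carrier[OF T0_schur] T0 by auto
  have detP: "det P \<noteq> 0" using det_nonzero_if_inverse[OF P P' w(1)] by simp
  obtain R where R: "R \<in> carrier_mat n n" "upper_triangular R" "det R \<noteq> 0"
    "transpose_mat R * R = transpose_mat P * P"
    using cholesky[OF _ pos_def_gram[OF P detP], of n] P by auto
  obtain Q where Q: "Q \<in> carrier_mat n n" "R * Q = 1\<^sub>m n" "Q * R = 1\<^sub>m n"
    using obtain_inverse_mat[OF R(1,3)] .
  have M: "?M \<in> carrier_mat n n" by (simp add: equiangular_gram_def)
  obtain L where L: "L \<in> carrier_mat n n" "upper_triangular L" "det L \<noteq> 0" "transpose_mat L * L = ?M"
    using cholesky[OF M pos_def_equiangular_gram[OF assms(1-3)]] by auto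
  obtain L' where L': "L' \<in> carrier_mat n n" "L * L' = 1\<^sub>m n" "L' * L = 1\<^sub>m n"
    using obtain_inverse_mat[OF L(1,3)] .
  have ut: "upper_triangular Q" "upper_triangular L'"
    using upper_triangular_inverse R L Q L' by blast+
  \<comment> \<open>Here \<open>P * Q\<close> has orthonormal columns, as \<open>Q\<close> inverts
    the Cholesky factor \<open>R\<close> of the Gram matrix of \<open>P\<close>; the factor
    \<open>L\<close> then installs the Gram matrix \<open>?M\<close>. Both \<open>Q\<close> and
    \<open>L\<close> are upper triangular, so the columns of \<open>P\<close> are recombined
    triangularly.\<close>
  define S where "S = P * (Q * L)"
  define S' where "S' = (L' * R) * P'"
  define T where "T = L' * (R * T0 * Q) * L"
  have "similar_mat_wit T0 (R * T0 * Q) Q R"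
  proof (rule similar_mat_witI[OF Q(3,2) _ T0])
    have "Q * (R * T0 * Q) * R = (Q * R) * T0 * (Q * R)" using Q(1) R(1) T0 by simp
    then show "T0 = Q * (R * T0 * Q) * R" using Q T0 by simp
  qed (use Q R T0 in auto)
  moreover have "similar_mat_wit (R * T0 * Q) T L L'"
  proof (rule similar_mat_witI[OF L'(2,3)])
    have "L * T * L' = (L * L') * (R * T0 * Q) * (L * L')"
      unfolding T_def using L(1) L'(1) Q(1) R(1) T0 by simp
    then show "R * T0 * Q = L * T * L'" using L' Q(1) R(1) T0 by simp
  qed (use Q R T0 L L' in \<open>auto simp: T_def\<close>)
  ultimately have "similar_mat_wit T0 T (Q * L) (L' * R)" by (rule similar_mat_wit_trans)
  then have simAT: "similar_mat_wit A T S S'"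
    unfolding S_def S'_def by (rule similar_mat_wit_trans[OF wit])
  note s = similar_mat_witD2[OF A simAT]
  \<comment> \<open>The brackets in \<open>T\<close> exhibit two successive triangular conjugations,
    by \<open>R\<close> with inverse \<open>Q\<close> and by \<open>L'\<close> with inverse
    \<open>L\<close>; each keeps the quasi-triangular form.\<close>
  have T_schur: "real_schur ns T"
    unfolding T_def using Q R L L' ut ns T0_schur
    by (intro real_schur_upper_triangular_conj[where n = n]) auto
  \<comment> \<open>The inner factor is (RQ)^T (RQ), the identity, so only L^T L = \<open>?M\<close>
    remains. Its entries are the scalar products of the columns of \<open>S\<close>.\<close>
  have "transpose_mat S * S = transpose_mat L * (transpose_mat Q * (transpose_mat P * P) * Q) * L"
    unfolding S_def using P Q(1) L(1) by (simp add: transpose_mult[of _ n n _ n])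
  also have "transpose_mat Q * (transpose_mat P * P) * Q = transpose_mat (R * Q) * (R * Q)"
    unfolding R(4)[symmetric] using Q(1) R(1) by (simp add: transpose_mult[of _ n n _ n])
  also have "transpose_mat L * (transpose_mat (R * Q) * (R * Q)) * L = ?M"
    using L Q by simp
  finally have gram: "transpose_mat S * S = ?M" .
  have col: "col S i \<bullet> col S j = (if i = j then 1 else \<alpha>)" if "i < n" "j < n" for i j
    using arg_cong[OF gram, of "\<lambda>M. M $$ (i,j)"] that s(6) by (simp add: equiangular_gram_def)
  have inv: "inverts_mat S S'" "inverts_mat S' S" using s by (auto simp: inverts_mat_def)
  then have "S \<in> EM n \<alpha>"
    using s(6) col unfolding EM_def invertible_mat_def by auto
  moreover have "S' * A * S = T" using similar_mat_witD2(3)[OF s(5) similar_mat_wit_sym[OF simAT]] by (rule sym)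
  moreover have "similar_mat A T" using simAT unfolding similar_mat_def by blast
  note complex_spectrum_similar[OF this] alg_multiplicity_similar[OF this]
  moreover have "\<exists>x. complex_spectrum (block ns T k k) = {complex_of_real x}"
    if "k < length ns" "ns ! k = 1" for k
    using real_schur_diagonal_blocks(4)[OF T_schur] that complex_spectrum_1x1 by metis
  ultimately show ?thesis
    using inv s(5,7) ns real_schur_diagonal_blocks[OF T_schur] real_schur_block_upper_triangular[OF T_schur]
    by (intro bexI[of _ S] bexI[of _ S'] bexI[of _ T] exI[of _ ns]) simp_all
qed

end
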